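(* Let $m\ge 3$ be an odd integer. Then for every $n\ge 0$, \[ p_m(n,-1)=(-1)^n p_m(n,1). \] In particular $|p_m(n,-1)|\to\infty$ as $n\to\infty$, and $p_m(n,-1)\neq 0$ for all $n$.
   Context: The $m$-ary partition polynomials $p_m(n,t)$ are defined by the power series expansion $\prod_{j=0}^{\infty}\frac{1}{1-tq^{m^j}}=\sum_{n=0}^{\infty}p_m(n,t)q^n$; in particular $p_m(n,1)$ is the number of partitions of $n$ into powers of $m$. *)

theory Defs
  imports "HOL-Analysis.Analysis" "HOL-Computational_Algebra.Polynomial"
    "HOL-Computational_Algebra.Formal_Power_Series"
begin

text \<open>
  The variable \<open>t\<close> is the polynomial \<open>[:0, 1:]\<close> over the integers and \<open>q\<close> is \<^const>\<open>fps_X\<close>.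
  Integer polynomials carry no \<^const>\<open>inverse\<close>, so \<open>1 / (1 - t q^(m^j))\<close> is written with
  \<open>fps_right_inverse\<close>, whose second argument is the inverse of the constant coefficient.
\<close>

definition mary_factor :: "nat \<Rightarrow> nat \<Rightarrow> int poly fps" where
  "mary_factor m j = fps_right_inverse (1 - fps_const [:0, 1:] * fps_X ^ (m ^ j)) 1"

definition mary_gf :: "nat \<Rightarrow> int poly fps" where
  "mary_gf m = (\<Prod>j. mary_factor m j)"

definition mary_poly :: "nat \<Rightarrow> nat \<Rightarrow> int poly" where
  "mary_poly m n = fps_nth (mary_gf m) n"

lemma mary_factor_inverse:
  assumes "m \<ge> 2"
  shows "(1 - fps_const [:0, 1:] * fps_X ^ (m ^ j)) * mary_factor m j = 1"
  unfolding mary_factor_def using assms by (intro fps_right_inverse) simp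

lemma mary_factor_nth:
  assumes "m \<ge> 2"
  shows "fps_nth (mary_factor m j) k =
    (if k = 0 then 1 else if k < m ^ j then 0 else [:0, 1:] * fps_nth (mary_factor m j) (k - m ^ j))"
proof -
  have "mary_factor m j = 1 + fps_const [:0, 1:] * (fps_X ^ (m ^ j) * mary_factor m j)"
    by (subst mary_factor_inverse[OF assms, of j, symmetric])
       (simp only: left_diff_distrib mult_1_left mult.assoc diff_add_cancel)
  from arg_cong[OF this, of "\<lambda>f. fps_nth f k"]
  have "fps_nth (mary_factor m j) k =
      fps_nth (1 + fps_const [:0, 1:] * (fps_X ^ (m ^ j) * mary_factor m j)) k" .
  also have "\<dots> = (if k = 0 then 1 else if k < m ^ j then 0
      else [:0, 1:] * fps_nth (mary_factor m j) (k - m ^ j))"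
    using assms by (auto simp: fps_X_power_mult_nth)
  finally show ?thesis .
qed

lemma mary_factor_nth_small:
  assumes "m \<ge> 2" "k < m ^ j"
  shows "fps_nth (mary_factor m j) k = (if k = 0 then 1 else 0)"
  by (subst mary_factor_nth[OF assms(1)]) (use assms(2) in simp)

lemma mary_partial_prod_nth:
  assumes "m \<ge> 2" "n \<le> N"
  shows "fps_nth (\<Prod>j\<le>N. mary_factor m j) n = fps_nth (\<Prod>j\<le>n. mary_factor m j) n"
  using assms(2)
proof (induction N rule: dec_induct)
  case (step N)
  have small: "n < m ^ Suc N"
  proof -
    have "n < 2 ^ Suc N" using step.hyps less_exp[of "Suc N"] by linarith
    also have "\<dots> \<le> m ^ Suc N" using assms(1) by (intro power_mono) auto
    finally show ?thesis .
  qed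
  have "fps_nth (\<Prod>j\<le>Suc N. mary_factor m j) n =
      (\<Sum>i=0..n. fps_nth (mary_factor m (Suc N)) i * fps_nth (\<Prod>j\<le>N. mary_factor m j) (n - i))"
    by (simp only: prod.atMost_Suc mult.commute[of _ "mary_factor m (Suc N)"] fps_mult_nth)
  also have "\<dots> = (\<Sum>i=0..n. if i = 0 then fps_nth (\<Prod>j\<le>N. mary_factor m j) n else 0)"
    using small by (intro sum.cong) (simp_all add: mary_factor_nth_small[OF assms(1)])
  finally show ?case using step.IH by simp
qed simp

lemma mary_gf_has_prod:
  assumes "m \<ge> 2"
  shows "mary_factor m has_prod mary_gf m"
proof -
  define P where "P = Abs_fps (\<lambda>n. fps_nth (\<Prod>j\<le>n. mary_factor m j) n)"
  have "(\<lambda>N. \<Prod>j\<le>N. mary_factor m j) \<longlonglongrightarrow> P"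
  proof (rule tendsto_fpsI)
    fix n
    show "\<forall>\<^sub>F N in sequentially. fps_nth (\<Prod>j\<le>N. mary_factor m j) n = fps_nth P n"
      using eventually_ge_at_top[of n]
      by eventually_elim (simp only: P_def fps_nth_Abs_fps, rule mary_partial_prod_nth[OF assms])
  qed
  moreover have "fps_nth P 0 = 1"
    by (use assms in \<open>simp add: P_def mary_factor_nth_small[OF assms]\<close>)
  then have "P \<noteq> 0" by auto
  ultimately have hp: "mary_factor m has_prod P"
    unfolding has_prod_def raw_has_prod_def by simp
  from has_prod_unique[OF this] have "mary_gf m = P"
    unfolding mary_gf_def by (rule sym)
  with hp show ?thesis by (simp only:)
qed

end

theory Submission
  imports Defs
begin

text \<open>
  For odd \<open>m\<close> every exponent \<open>m^j\<close> is odd, so each factor \<open>1 / (1 - t q^(m^j))\<close> is invariant under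
  \<open>(t, q) \<mapsto> (-t, -q)\<close>, and hence so is the product. For \<open>t \<ge> 1\<close> all factors have nonnegative
  coefficients and constant coefficient 1, so the coefficient of \<open>q^n\<close> in the product is bounded
  below by that in the first two factors alone, to which each of the \<open>\<lfloor>n / m\<rfloor> + 1\<close> partitions of
  \<open>n\<close> into parts \<open>1\<close> and \<open>m\<close> contributes a power of \<open>t\<close>.
\<close>

definition fps_specialize :: "'a::comm_semiring_1 \<Rightarrow> 'a poly fps \<Rightarrow> 'a fps" where
  "fps_specialize x F = Abs_fps (\<lambda>n. poly (fps_nth F n) x)"

lemma fps_specialize_nth [simp]: "fps_nth (fps_specialize x F) n = poly (fps_nth F n) x"
  by (simp add: fps_specialize_def)

lemma fps_specialize_1 [simp]: "fps_specialize x 1 = 1"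
  by (simp add: fps_eq_iff)

lemma fps_specialize_mult: "fps_specialize x (F * G) = fps_specialize x F * fps_specialize x G"
  by (simp add: fps_eq_iff fps_mult_nth poly_sum)

lemma fps_specialize_prod: "fps_specialize x (\<Prod>j\<in>A. F j) = (\<Prod>j\<in>A. fps_specialize x (F j))"
  by (induction A rule: infinite_finite_induct) (simp_all add: fps_specialize_mult)

lemma fps_nth_mult_nonneg:
  fixes F G :: "'a::linordered_semidom fps"
  assumes "\<And>n. 0 \<le> fps_nth F n" "\<And>n. 0 \<le> fps_nth G n"
  shows "0 \<le> fps_nth (F * G) n"
  using assms by (simp add: fps_mult_nth sum_nonneg)

lemma fps_nth_prod_nonneg:
  fixes F :: "'i \<Rightarrow> 'a::linordered_semidom fps"
  assumes "\<And>i n. i \<in> A \<Longrightarrow> 0 \<le> fps_nth (F i) n"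
  shows "0 \<le> fps_nth (\<Prod>i\<in>A. F i) n"
  using assms
  by (induction A arbitrary: n rule: infinite_finite_induct) (simp_all add: fps_nth_mult_nonneg)

lemma fps_nth_le_mult:
  fixes F G :: "'a::linordered_semidom fps"
  assumes "\<And>n. 0 \<le> fps_nth F n" "\<And>n. 0 \<le> fps_nth G n" "fps_nth G 0 = 1"
  shows "fps_nth F n \<le> fps_nth (F * G) n"
proof -
  have "fps_nth F n = fps_nth F n * fps_nth G (n - n)"
    using assms(3) by simp
  also have "\<dots> \<le> (\<Sum>i=0..n. fps_nth F i * fps_nth G (n - i))"
    using assms(1,2) by (intro member_le_sum) simp_all
  finally show ?thesis
    by (simp add: fps_mult_nth)
qed

lemma fps_nth_0_prod:
  fixes F :: "'i \<Rightarrow> 'a::comm_semiring_1 fps"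
  shows "fps_nth (\<Prod>i\<in>A. F i) 0 = (\<Prod>i\<in>A. fps_nth (F i) 0)"
  by (induction A rule: infinite_finite_induct) simp_all

lemma fps_nth_prod_mono_subset:
  fixes F :: "'i \<Rightarrow> 'a::linordered_semidom fps"
  assumes "finite B" "A \<subseteq> B"
    and nonneg: "\<And>i n. i \<in> B \<Longrightarrow> 0 \<le> fps_nth (F i) n"
    and "\<And>i. i \<in> B \<Longrightarrow> fps_nth (F i) 0 = 1"
  shows "fps_nth (\<Prod>i\<in>A. F i) n \<le> fps_nth (\<Prod>i\<in>B. F i) n"
proof -
  have "fps_nth (\<Prod>i\<in>A. F i) n \<le> fps_nth ((\<Prod>i\<in>A. F i) * (\<Prod>i\<in>B - A. F i)) n"
    using assms by (intro fps_nth_le_mult fps_nth_prod_nonneg) (auto simp: fps_nth_0_prod)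
  also have "(\<Prod>i\<in>A. F i) * (\<Prod>i\<in>B - A. F i) = (\<Prod>i\<in>B. F i)"
    using prod.subset_diff[OF assms(2,1), of F] by (simp add: mult.commute)
  finally show ?thesis .
qed

lemma mary_factor_nth_eq_monom:
  assumes "m \<ge> 2"
  shows "fps_nth (mary_factor m j) k = (if m ^ j dvd k then monom 1 (k div m ^ j) else 0)"
proof (induction k rule: less_induct)
  case (less k)
  consider (zero) "k = 0" | (small) "0 < k" "k < m ^ j" | (large) "0 < k" "m ^ j \<le> k"
    by linarith
  then show ?case
  proof cases
    case zero
    then show ?thesis
      using assms by (simp add: mary_factor_nth_small)
  next
    case small
    then show ?thesis
      using assms by (auto simp: mary_factor_nth_small dest: dvd_imp_le)
  next
    case large
    then have "fps_nth (mary_factor m j) k = [:0, 1:] * fps_nth (mary_factor m j) (k - m ^ j)"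
      using mary_factor_nth[OF assms, of j k] by simp
    moreover have "k - m ^ j < k" "k div m ^ j = Suc ((k - m ^ j) div m ^ j)"
      using large assms by (simp_all add: le_div_geq)
    ultimately show ?thesis
      using less.IH[of "k - m ^ j"] large by (simp add: monom_Suc dvd_minus_self)
  qed
qed

lemma poly_mary_factor_nth:
  assumes "m \<ge> 2"
  shows "poly (fps_nth (mary_factor m j) k) x = (if m ^ j dvd k then x ^ (k div m ^ j) else 0)"
  by (simp add: mary_factor_nth_eq_monom[OF assms] poly_monom)

lemma mary_poly_eq_nth_partial_prod:
  assumes "m \<ge> 2" "n \<le> N"
  shows "mary_poly m n = fps_nth (\<Prod>j\<le>N. mary_factor m j) n"
proof -
  have "\<forall>\<^sub>F M in sequentially. fps_nth (\<Prod>j\<le>M. mary_factor m j) n = mary_poly m n"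
    using has_prod_imp_tendsto[OF mary_gf_has_prod[OF assms(1)]]
    by (simp add: tendsto_fps_iff mary_poly_def)
  then have "\<forall>\<^sub>F M in sequentially. mary_poly m n = fps_nth (\<Prod>j\<le>N. mary_factor m j) n"
    using eventually_ge_at_top[of n]
    by eventually_elim (use mary_partial_prod_nth[OF assms(1)] assms(2) in metis)
  then show ?thesis
    by simp
qed

lemma poly_mary_poly_eq_nth_partial_prod:
  assumes "m \<ge> 2" "n \<le> N"
  shows "poly (mary_poly m n) x = fps_nth (\<Prod>j\<le>N. fps_specialize x (mary_factor m j)) n"
  by (simp add: mary_poly_eq_nth_partial_prod[OF assms] flip: fps_specialize_prod)

lemma fps_specialize_uminus_mary_factor:
  assumes "m \<ge> 2" "odd m"
  shows "fps_specialize (- x) (mary_factor m j) = fps_specialize x (mary_factor m j) oo - fps_X"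
proof (rule fps_ext)
  fix k
  have "(- x) ^ (k div m ^ j) = (-1) ^ k * x ^ (k div m ^ j)" if "m ^ j dvd k"
  proof -
    have "even k \<longleftrightarrow> even (m ^ j * (k div m ^ j))"
      using that by simp
    also have "\<dots> \<longleftrightarrow> even (k div m ^ j)"
      using assms(2) by simp
    finally show ?thesis
      by (simp add: power_minus[of x] minus_one_power_iff)
  qed
  then show "fps_nth (fps_specialize (- x) (mary_factor m j)) k
      = fps_nth (fps_specialize x (mary_factor m j) oo - fps_X) k"
    by (simp add: fps_compose_uminus' poly_mary_factor_nth[OF assms(1)])
qed

lemma poly_mary_poly_uminus:
  assumes "m \<ge> 2" "odd m"
  shows "poly (mary_poly m n) (- x) = (-1) ^ n * poly (mary_poly m n) x"
proof -
  have "(\<Prod>j\<le>n. fps_specialize (- x) (mary_factor m j))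
      = (\<Prod>j\<le>n. fps_specialize x (mary_factor m j)) oo - fps_X"
    by (simp add: fps_specialize_uminus_mary_factor[OF assms] fps_compose_prod_distrib)
  then show ?thesis
    by (simp add: poly_mary_poly_eq_nth_partial_prod[OF assms(1) order_refl] fps_compose_uminus')
qed

lemma card_multiples_upto:
  fixes m n :: nat
  assumes "m > 0"
  shows "card {i \<in> {0..n}. m dvd i} = n div m + 1"
proof -
  have "{i \<in> {0..n}. m dvd i} = (\<lambda>k. m * k) ` {..n div m}"
    using assms by (auto simp: less_eq_div_iff_mult_less_eq mult.commute elim!: dvdE)
  moreover have "inj_on (\<lambda>k. m * k) {..n div m}"
    using assms by (simp add: inj_on_def)
  ultimately show ?thesis
    by (simp add: card_image)
qed

lemma poly_mary_factor_0_1_nth_ge: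
  assumes "m \<ge> 2" "x \<ge> 1"
  shows "int (n div m) + 1 \<le> poly (fps_nth (mary_factor m 1 * mary_factor m 0) n) x"
proof -
  have "int (n div m) + 1 = int (card {i \<in> {0..n}. m dvd i})"
    using card_multiples_upto[of m n] assms(1) by simp
  also have "\<dots> = (\<Sum>i=0..n. if m dvd i then 1 else 0)"
    by (simp add: sum.If_cases Int_def)
  also have "\<dots> \<le> (\<Sum>i=0..n. (if m dvd i then x ^ (i div m) else 0) * x ^ (n - i))"
    using assms(2) by (intro sum_mono) (auto simp flip: power_add)
  also have "\<dots> = poly (fps_nth (mary_factor m 1 * mary_factor m 0) n) x"
    by (simp add: fps_mult_nth poly_sum poly_mary_factor_nth[OF assms(1)] cong: if_cong)
  finally show ?thesis .
qed

lemma poly_mary_poly_ge: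
  assumes "m \<ge> 2" "x \<ge> 1"
  shows "int (n div m) + 1 \<le> poly (mary_poly m n) x"
proof -
  define F where "F j = fps_specialize x (mary_factor m j)" for j
  have "int (n div m) + 1 \<le> fps_nth (\<Prod>j\<in>{1, 0}. F j) n"
    using poly_mary_factor_0_1_nth_ge[OF assms] by (simp add: F_def flip: fps_specialize_mult)
  also have "\<dots> \<le> fps_nth (\<Prod>j\<le>Suc n. F j) n"
    using assms by (intro fps_nth_prod_mono_subset) (auto simp: F_def poly_mary_factor_nth)
  also have "\<dots> = poly (mary_poly m n) x"
    by (simp only: F_def poly_mary_poly_eq_nth_partial_prod[OF assms(1) le_SucI[OF order_refl]])
  finally show ?thesis .
qed

lemma filterlim_poly_mary_poly:
  assumes "m \<ge> 2" "x \<ge> 1"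
  shows "filterlim (\<lambda>n. poly (mary_poly m n) x) at_top at_top"
proof (rule filterlim_at_top_mono)
  show "filterlim (\<lambda>n. int (n div m)) at_top at_top"
    using assms(1)
    by (intro filterlim_compose[OF filterlim_int_sequentially] filterlim_at_top_div_const_nat) simp
  have "int (n div m) \<le> poly (mary_poly m n) x" for n
    using poly_mary_poly_ge[OF assms, of n] by linarith
  then show "\<forall>\<^sub>F n in at_top. int (n div m) \<le> poly (mary_poly m n) x"
    by simp
qed

theorem theorem3p6:
  fixes m :: nat
  assumes "m \<ge> 3" and "odd m"
  shows "(\<forall>n. poly (mary_poly m n) (-1) = (-1) ^ n * poly (mary_poly m n) 1)
    \<and> filterlim (\<lambda>n. \<bar>poly (mary_poly m n) (-1)\<bar>) at_top at_top
    \<and> (\<forall>n. poly (mary_poly m n) (-1) \<noteq> 0)"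
proof -
  have m_ge_2: "m \<ge> 2"
    using assms(1) by simp
  have parity: "poly (mary_poly m n) (-1) = (-1) ^ n * poly (mary_poly m n) 1" for n
    by (rule poly_mary_poly_uminus[OF m_ge_2 assms(2)])
  have pos: "poly (mary_poly m n) 1 > 0" for n
    using poly_mary_poly_ge[OF m_ge_2 order_refl, of n] by linarith
  have "\<bar>poly (mary_poly m n) (-1)\<bar> = poly (mary_poly m n) 1" for n
    using pos[of n] by (simp add: parity abs_mult power_abs)
  then have "filterlim (\<lambda>n. \<bar>poly (mary_poly m n) (-1)\<bar>) at_top at_top"
    using filterlim_poly_mary_poly[OF m_ge_2 order_refl] by simp
  moreover have "poly (mary_poly m n) (-1) \<noteq> 0" for n
    using pos[of n] by (simp add: parity)
  ultimately show ?thesis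
    using parity by blast
qed

end
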